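(* Let $G=(V,E)$ be a simple, undirected, connected graph on $n\ge 2$ vertices with adjacency matrix $A=(a_{uv})$, adjacency eigenvalues $\lambda_1 \ge \dots \ge \lambda_n$ and normalized Perron eigenvector $\nu$. Let $\lambda = \max\{|\lambda_2|,|\lambda_n|\}$. Let $S,T\subseteq V$ and $\tilde{b}^{*}_{ST}=\sum_{u \in S,\,v \in T}a_{uv}\nu_{u}\nu_{v}$. Then $$\left|\tilde{b}^{*}_{ST} - \lambda_1 \|\rho(S) \|^2 \|\rho(T)\|^2\right| \le \lambda\,\|\rho(S)\|\,\|\rho(T)\|\,\|\rho(\overline{S})\|\,\|\rho(\overline{T})\|.$$
   Context: The normalized Perron eigenvector $\nu=(\nu_v)_{v\in V}$ is the unique eigenvector of $A$ for $\lambda_1$ with all entries positive and Euclidean norm $1$. For $U\subseteq V$, $\rho(U)=\sum_{u\in U}\nu_u e_u\in\mathbb{R}^V$, where $e_u$ is the standard basis vector indexed by $u$ (and $\rho(\emptyset)=0$), so $\|\rho(U)\|^2=\sum_{u\in U}\nu_u^2$. $\overline{U}=V\setminus U$, and $\|\cdot\|$ is the Euclidean norm. *)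

theory Defs
  imports "HOL-Analysis.Analysis" "HOL-Computational_Algebra.Polynomial"
begin

text \<open>A simple undirected graph with vertex set \<open>UNIV :: 'v set\<close> is given by its symmetric,
  irreflexive adjacency relation.\<close>

definition adjacency_matrix :: "('v::finite) rel \<Rightarrow> real ^ 'v ^ 'v" where
  "adjacency_matrix E = (\<chi> u v. if (u, v) \<in> E then 1 else 0)"

definition charpoly :: "real ^ 'v ^ 'v \<Rightarrow> real poly" where
  "charpoly A = det (mat [:0, 1:] - (\<chi> i j. [:A $ i $ j:]))"

text \<open>The real eigenvalues, repeated according to algebraic multiplicity and in decreasing order.
  For a symmetric matrix this is the whole spectrum, so the list has length \<open>CARD('v)\<close>.\<close>

definition eigenvalues :: "real ^ 'v ^ 'v \<Rightarrow> real list" where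
  "eigenvalues A = rev (sorted_list_of_multiset (proots (charpoly A)))"

text \<open>Counted from 1: \<open>eigval A 1\<close> is the largest eigenvalue, \<open>eigval A CARD('v)\<close> the smallest
  one if \<open>A\<close> is symmetric.\<close>

definition eigval :: "real ^ 'v ^ 'v \<Rightarrow> nat \<Rightarrow> real" where
  "eigval A i = eigenvalues A ! (i - 1)"

text \<open>Well defined when \<open>A\<close> is the adjacency matrix of a connected graph, by the
  Perron--Frobenius theorem.\<close>

definition perron_vector :: "real ^ 'v ^ 'v \<Rightarrow> real ^ 'v" where
  "perron_vector A =
    (THE x. A *v x = eigval A 1 *\<^sub>R x \<and> (\<forall>v. 0 < x $ v) \<and> norm x = 1)"

definition rho :: "real ^ 'v \<Rightarrow> 'v set \<Rightarrow> real ^ 'v" where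
  "rho \<nu> U = (\<Sum>u\<in>U. (\<nu> $ u) *\<^sub>R axis u 1)"

end

theory Submission
  imports Defs
begin

text \<open>Since \<open>rho \<nu> U \<bullet> \<nu> = (norm (rho \<nu> U))\<^sup>2\<close>, subtracting from \<open>rho \<nu> S\<close> and \<open>rho \<nu> T\<close> their
  projections onto \<open>\<nu>\<close> leaves vectors orthogonal to \<open>\<nu>\<close>, of norm
  \<open>norm (rho \<nu> U) * norm (rho \<nu> (- U))\<close> for \<open>U = S, T\<close>. The form \<open>x \<bullet> (A *v y)\<close> of these
  two remainders is exactly \<open>b\<close> minus its main term, and in an orthonormal eigenbasis it only
  involves the eigenvalues other than the largest one, so Cauchy--Schwarz gives the bound.
  That \<open>\<nu>\<close> is, up to sign, a member of the eigenbasis follows from the variational half of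
  Perron--Frobenius: if \<open>x\<close> maximizes the Rayleigh quotient then so does \<open>\<bar>x\<bar>\<close>.\<close>

section \<open>Spectral theorem for real symmetric matrices\<close>

lemma symmetric_inner_swap:
  fixes A :: "real ^ 'n ^ 'n"
  assumes "transpose A = A"
  shows "x \<bullet> (A *v y) = (A *v x) \<bullet> y"
  by (metis assms dot_lmul_matrix vector_transpose_matrix)

text \<open>A first-order optimality argument without derivatives: the form \<open>q\<close> below
  is nonnegative on \<open>W\<close> and minimal at \<open>x\<close>, so along the line
  \<open>x - e *\<^sub>R h\<close> its linear term \<open>- 2 * e * (h \<bullet> h)\<close> must
  vanish. Invariance of \<open>W\<close> keeps this line inside \<open>W\<close>.\<close>

lemma rayleigh_maximizer_eigenvector:
  fixes A :: "real ^ 'n ^ 'n"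
  assumes sym: "transpose A = A" and W: "subspace W" "\<And>z. z \<in> W \<Longrightarrow> A *v z \<in> W"
    and le: "\<And>z. z \<in> W \<Longrightarrow> z \<bullet> (A *v z) \<le> \<mu> * (z \<bullet> z)"
    and x: "x \<in> W" "\<mu> * (x \<bullet> x) \<le> x \<bullet> (A *v x)"
  shows "A *v x = \<mu> *\<^sub>R x"
proof -
  define q where "q z = \<mu> * (z \<bullet> z) - z \<bullet> (A *v z)" for z
  \<comment> \<open>Half the gradient of \<open>q\<close> at \<open>x\<close>, so moving along
    \<open>- h\<close> is steepest descent.\<close>
  define h where "h = \<mu> *\<^sub>R x - A *v x"
  have hW: "h \<in> W"
    unfolding h_def using W x by (intro subspace_diff subspace_scale)
  have qx: "q x \<le> 0" and qh: "0 \<le> q h"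
    using x le[OF hW] by (auto simp: q_def)
  have hh: "h \<bullet> h = \<mu> * (x \<bullet> h) - (A *v x) \<bullet> h"
    by (simp add: h_def inner_diff_left)
  have "q (x - e *\<^sub>R h) = q x - 2 * e * (\<mu> * (x \<bullet> h) - (A *v x) \<bullet> h) + e\<^sup>2 * q h" for e
    unfolding q_def
    by (simp add: matrix_vector_mult_diff_distrib matrix_vector_mult_scaleR inner_diff_left
        inner_diff_right symmetric_inner_swap[OF sym, of x h] inner_commute[of h x]
        inner_commute[of h "A *v x"] power2_eq_square algebra_simps)
  moreover have "0 \<le> q (x - e *\<^sub>R h)" for e
    using le[of "x - e *\<^sub>R h"] W(1) hW x(1)
    by (simp add: q_def subspace_diff subspace_scale)
  ultimately have *: "2 * e * (h \<bullet> h) \<le> e\<^sup>2 * q h" for e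
    using qx by (smt (verit) hh)
  \<comment> \<open>adding 1 keeps the denominator positive when \<open>q h = 0\<close>\<close>
  define e where "e = (h \<bullet> h) / (q h + 1)"
  have e: "e * q h \<le> h \<bullet> h" "0 \<le> e"
    using qh by (auto simp: e_def field_simps)
  have "e * (h \<bullet> h) \<le> 0"
  proof -
    have "e\<^sup>2 * q h \<le> e * (h \<bullet> h)"
      using mult_left_mono[OF e] by (simp add: power2_eq_square mult.assoc)
    then show ?thesis
      using *[of e] by linarith
  qed
  then have "(h \<bullet> h) * (h \<bullet> h) \<le> 0"
    using qh by (simp add: e_def divide_le_0_iff)
  then have "h = 0"
    by (metis inner_eq_zero_iff inner_ge_zero mult_le_0_iff order_antisym)
  then show ?thesis
    by (simp add: h_def)
qed

text \<open>The Rayleigh quotient attains its maximum on the unit sphere of \<open>W\<close>, which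
  is compact, and nonempty because of \<open>y\<close>. By homogeneity the maximum bounds the form
  on all of \<open>W\<close>, so the maximizer is an eigenvector.\<close>

lemma invariant_subspace_unit_eigenvector:
  fixes A :: "real ^ 'n ^ 'n"
  assumes sym: "transpose A = A" and W: "subspace W" "\<And>z. z \<in> W \<Longrightarrow> A *v z \<in> W"
    and y: "y \<in> W" "y \<noteq> 0"
  obtains x \<mu> where "x \<in> W" "norm x = 1" "A *v x = \<mu> *\<^sub>R x"
proof -
  define K where "K = W \<inter> sphere 0 1"
  have "compact K"
    unfolding K_def by (intro closed_Int_compact closed_subspace W compact_sphere)
  moreover have "y /\<^sub>R norm y \<in> K"
    using y W by (auto simp: K_def subspace_scale)
  moreover have "continuous_on K (\<lambda>x. x \<bullet> (A *v x))"
    by (intro continuous_on_inner continuous_on_id matrix_vector_mult_linear_continuous_on)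
  ultimately obtain x where x: "x \<in> K" and max: "\<And>z. z \<in> K \<Longrightarrow> z \<bullet> (A *v z) \<le> x \<bullet> (A *v x)"
    using continuous_attains_sup[of K "\<lambda>x. x \<bullet> (A *v x)"] by blast
  define \<mu> where "\<mu> = x \<bullet> (A *v x)"
  have "z \<bullet> (A *v z) \<le> \<mu> * (z \<bullet> z)" if z: "z \<in> W" for z
  proof (cases "z = 0")
    case False
    have "z /\<^sub>R norm z \<in> K"
      using z W False by (auto simp: K_def subspace_scale)
    from max[OF this] have "(z \<bullet> (A *v z)) / (norm z)\<^sup>2 \<le> \<mu>"
      by (simp add: \<mu>_def matrix_vector_mult_scaleR power2_eq_square divide_inverse mult_ac)
    then show ?thesis
      using False by (simp add: divide_le_eq power2_norm_eq_inner)
  qed simp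
  moreover have "x \<in> W" "norm x = 1" "x \<bullet> x = 1"
    using x by (auto simp: K_def norm_eq_1)
  ultimately show ?thesis
    using rayleigh_maximizer_eigenvector[OF sym W, of \<mu> x] that[of x \<mu>] by (simp add: \<mu>_def)
qed

text \<open>By symmetry, the orthogonal complement of the eigenvectors found so far is invariant
  under \<open>A\<close>. While there are fewer than \<open>CARD('n)\<close> of them it is nonzero
  and supplies one more.\<close>

lemma symmetric_orthonormal_eigenvectors:
  fixes A :: "real ^ 'n ^ 'n"
  assumes sym: "transpose A = A" and "k \<le> CARD('n)"
  shows "\<exists>B. finite B \<and> card B = k \<and> pairwise orthogonal B
    \<and> (\<forall>b\<in>B. norm b = 1 \<and> (\<exists>\<mu>. A *v b = \<mu> *\<^sub>R b))"
  using assms(2)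
proof (induction k)
  case 0
  show ?case
    by (intro exI[of _ "{}"]) auto
next
  case (Suc k)
  then obtain B where B: "finite B" "card B = k" "pairwise orthogonal B"
    "\<forall>b\<in>B. norm b = 1 \<and> (\<exists>\<mu>. A *v b = \<mu> *\<^sub>R b)"
    by auto
  define W where "W = {y. \<forall>b\<in>B. orthogonal b y}"
  have W: "subspace W"
    unfolding W_def by (rule subspace_orthogonal_to_vectors)
  have inv: "A *v z \<in> W" if "z \<in> W" for z
    unfolding W_def
  proof safe
    fix b assume b: "b \<in> B"
    then obtain \<mu> where "A *v b = \<mu> *\<^sub>R b"
      using B by blast
    then show "orthogonal b (A *v z)"
      using b that by (simp add: orthogonal_def symmetric_inner_swap[OF sym] W_def)
  qed
  have "dim B < DIM(real ^ 'n)"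
    using dim_le_card'[OF B(1)] B(2) Suc.prems by simp
  then obtain y where y: "y \<noteq> 0" "\<And>z. z \<in> span B \<Longrightarrow> orthogonal y z"
    using orthogonal_to_subspace_exists[of B] by blast
  then have "y \<in> W"
    by (auto simp: W_def orthogonal_commute span_base)
  then obtain x \<mu> where x: "x \<in> W" "norm x = 1" "A *v x = \<mu> *\<^sub>R x"
    using invariant_subspace_unit_eigenvector[OF sym W inv _ y(1)] by blast
  have "x \<notin> B"
    using x by (auto simp: W_def orthogonal_def norm_eq_1)
  then show ?case
    using B x by (intro exI[of _ "insert x B"])
      (auto simp: pairwise_insert W_def orthogonal_commute)
qed

text \<open>Indexing by \<open>'n\<close> makes the basis the rows of a square matrix and lets
  \<open>d\<close> record repeated eigenvalues.\<close>

lemma symmetric_eigenbasis: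
  fixes A :: "real ^ 'n ^ 'n"
  assumes "transpose A = A"
  obtains f :: "'n \<Rightarrow> real ^ 'n" and d :: "'n \<Rightarrow> real"
  where "\<And>i. A *v f i = d i *\<^sub>R f i" and "\<And>i j. f i \<bullet> f j = (if i = j then 1 else 0)"
proof -
  obtain B :: "(real ^ 'n) set" where B: "finite B" "card B = CARD('n)" "pairwise orthogonal B"
    "\<forall>b\<in>B. norm b = 1 \<and> (\<exists>\<mu>. A *v b = \<mu> *\<^sub>R b)"
    using symmetric_orthonormal_eigenvectors[OF assms order_refl] by blast
  obtain f :: "'n \<Rightarrow> real ^ 'n" where f: "bij_betw f UNIV B"
    using finite_same_card_bij[OF _ B(1), of "UNIV :: 'n set"] B(2) by auto
  then have fB: "f i \<in> B" for i
    by (auto simp: bij_betw_def)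
  then have "\<forall>i. \<exists>\<mu>. A *v f i = \<mu> *\<^sub>R f i"
    using B(4) by blast
  then obtain d where "\<And>i. A *v f i = d i *\<^sub>R f i"
    by (auto dest!: choice)
  moreover have "f i \<bullet> f j = (if i = j then 1 else 0)" for i j
  proof (cases "i = j")
    case True
    then show ?thesis
      using B(4) fB by (simp add: norm_eq_1)
  next
    case False
    then have "f i \<noteq> f j"
      using f by (auto simp: bij_betw_def dest: injD)
    then show ?thesis
      using False B(3) fB by (auto simp: pairwise_def orthogonal_def)
  qed
  ultimately show ?thesis
    using that by blast
qed

lemma orthonormal_orthogonal_matrix:
  fixes f :: "'n \<Rightarrow> real ^ 'n"
  assumes "\<And>i j. f i \<bullet> f j = (if i = j then 1 else 0)"
  shows "orthogonal_matrix (\<chi> i. f i)"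
proof -
  have "(\<chi> i. f i) ** transpose (\<chi> i. f i) = mat 1"
    using assms by (simp add: vec_eq_iff matrix_matrix_mult_def transpose_def mat_def inner_vec_def)
  then show ?thesis
    by (simp add: orthogonal_matrix_def matrix_left_right_inverse)
qed

text \<open>Parseval: the matrix with rows \<open>f i\<close> is orthogonal, hence preserves inner
  products, and it sends \<open>x\<close> to its coordinates \<open>f i \<bullet> x\<close>.\<close>

lemma orthonormal_inner_expand:
  fixes f :: "'n \<Rightarrow> real ^ 'n"
  assumes "\<And>i j. f i \<bullet> f j = (if i = j then 1 else 0)"
  shows "x \<bullet> y = (\<Sum>i\<in>UNIV. (f i \<bullet> x) * (f i \<bullet> y))"
proof -
  have "orthogonal_transformation ((*v) (\<chi> i. f i))"
    using orthonormal_orthogonal_matrix[OF assms] by (simp add: orthogonal_transformation_matrix)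
  then have "x \<bullet> y = ((\<chi> i. f i) *v x) \<bullet> ((\<chi> i. f i) *v y)"
    by (simp add: orthogonal_transformation_def)
  also have "\<dots> = (\<Sum>i\<in>UNIV. (f i \<bullet> x) * (f i \<bullet> y))"
    by (simp add: inner_vec_def matrix_vector_mult_def)
  finally show ?thesis .
qed

section \<open>Characteristic polynomial and the sorted list of eigenvalues\<close>

definition const_matrix :: "real ^ 'n ^ 'm \<Rightarrow> real poly ^ 'n ^ 'm" where
  "const_matrix M = (\<chi> i j. [:M $ i $ j:])"

lemma const_matrix_mult: "const_matrix (M ** N) = const_matrix M ** const_matrix N"
  by (simp add: const_matrix_def matrix_matrix_mult_def vec_eq_iff mult.commute flip: sum_to_poly)

lemma const_matrix_mat_1: "const_matrix (mat 1) = mat 1"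
  by (simp add: const_matrix_def mat_def vec_eq_iff one_pCons)

lemma matrix_diff_ldistrib: "A ** (B - C) = A ** B - A ** C"
  for A :: "'a::ring_1 ^ 'n ^ 'm"
  by (simp add: vec_eq_iff matrix_matrix_mult_def right_diff_distrib sum_subtractf)

lemma matrix_diff_rdistrib: "(A - B) ** C = A ** C - B ** C"
  for A :: "'a::ring_1 ^ 'n ^ 'm"
  by (simp add: vec_eq_iff matrix_matrix_mult_def left_diff_distrib sum_subtractf)

text \<open>Over the polynomial ring, \<open>Q\<close> intertwines \<open>X - A\<close> with
  \<open>X - D\<close>. Taking determinants, the factor \<open>det (const_matrix Q)\<close> cancels,
  being a unit.\<close>

lemma charpoly_similar:
  fixes A D Q R :: "real ^ 'n ^ 'n"
  assumes QR: "Q ** R = mat 1" and eq: "Q ** A = D ** Q"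
  shows "charpoly A = charpoly D"
proof -
  let ?X = "mat [:0, 1:] :: real poly ^ 'n ^ 'n"
  have "const_matrix Q ** const_matrix R = mat 1"
    by (metis QR const_matrix_mat_1 const_matrix_mult)
  then have "det (const_matrix Q) * det (const_matrix R) = 1"
    by (metis det_I det_mul)
  then have nz: "det (const_matrix Q) \<noteq> 0"
    by auto
  have comm: "const_matrix Q ** ?X = ?X ** const_matrix Q"
    by (simp add: vec_eq_iff matrix_matrix_mult_def mat_def if_distrib if_distribR
        mult.commute cong: if_cong)
  have "const_matrix Q ** (?X - const_matrix A) = (?X - const_matrix D) ** const_matrix Q"
    using comm eq
    by (simp add: matrix_diff_ldistrib matrix_diff_rdistrib flip: const_matrix_mult)
  then have "det (const_matrix Q) * charpoly A = charpoly D * det (const_matrix Q)"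
    unfolding charpoly_def const_matrix_def[symmetric] by (metis det_mul)
  then show ?thesis
    using nz by (simp add: mult.commute)
qed

lemma charpoly_diagonal:
  "charpoly (\<chi> i j. if i = j then d i else 0) = (\<Prod>i\<in>UNIV. [:- d i, 1:])"
  unfolding charpoly_def by (subst det_diagonal) (simp_all add: mat_def)

text \<open>This ties eigenvalues defined as roots to an eigenbasis: the matrix with rows
  \<open>f i\<close> conjugates \<open>A\<close> to the diagonal matrix of \<open>d\<close>, whose
  characteristic polynomial splits into linear factors.\<close>

lemma proots_charpoly_eigenbasis:
  fixes A :: "real ^ 'n ^ 'n" and f :: "'n \<Rightarrow> real ^ 'n"
  assumes sym: "transpose A = A" and ev: "\<And>i. A *v f i = d i *\<^sub>R f i"
    and on: "\<And>i j. f i \<bullet> f j = (if i = j then 1 else 0)"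
  shows "proots (charpoly A) = image_mset d (mset_set UNIV)"
proof -
  let ?Q = "\<chi> i. f i" and ?D = "\<chi> i j. if i = j then d i else 0"
  have "?Q ** transpose ?Q = mat 1"
    using orthonormal_orthogonal_matrix[OF on] by (simp add: orthogonal_matrix_def matrix_left_right_inverse)
  moreover have "?Q ** A = ?D ** ?Q"
  proof -
    have "(?Q ** A) $ i $ j = (A *v f i) $ j" for i j
    proof -
      have "A $ k $ j = A $ j $ k" for k
        by (metis sym transpose_def vec_lambda_beta)
      then show ?thesis
        by (simp add: matrix_matrix_mult_def matrix_vector_mult_def mult.commute)
    qed
    then show ?thesis
      by (simp add: vec_eq_iff ev matrix_matrix_mult_def if_distrib if_distribR cong: if_cong)
  qed
  ultimately have "charpoly A = charpoly ?D"
    by (rule charpoly_similar)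
  then have "charpoly A = (\<Prod>i\<in>UNIV. [:- d i, 1:])"
    by (simp only: charpoly_diagonal)
  then show ?thesis
    by (simp add: proots_prod sum_unfold_sum_mset)
qed

text \<open>A single index \<open>i\<close> is matched with the head of the sorted list, and all
  other indices with its tail. This covers a repeated largest eigenvalue too, since only one copy is
  removed.\<close>

lemma eigval_eigenbasis:
  fixes A :: "real ^ 'n ^ 'n" and d :: "'n \<Rightarrow> real"
  assumes "proots (charpoly A) = image_mset d (mset_set UNIV)"
  obtains i where "d i = eigval A 1" "\<And>j. d j \<le> eigval A 1"
    "\<And>j. j \<noteq> i \<Longrightarrow> eigval A CARD('n) \<le> d j \<and> d j \<le> eigval A 2"
proof -
  let ?L = "eigenvalues A"
  have mL: "mset ?L = image_mset d (mset_set UNIV)"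
    by (simp add: eigenvalues_def assms)
  have sL: "sorted (rev ?L)"
    by (simp add: eigenvalues_def)
  have len: "length ?L = CARD('n)"
    using arg_cong[OF mL, of size] by simp
  then obtain a L where L: "?L = a # L"
    by (metis length_0_conv neq_Nil_conv zero_less_card_finite less_irrefl)
  then have "a \<in># image_mset d (mset_set UNIV)"
    by (metis mL list.set_intros(1) set_mset_mset)
  then obtain i where i: "d i = a"
    by auto
  have anti: "?L ! n \<le> ?L ! m" if "m \<le> n" "n < CARD('n)" for m n
    using sL that len by (simp add: sorted_rev_nth_mono)
  have nth: "\<exists>k<CARD('n). d j = ?L ! k" for j
  proof -
    have "d j \<in> set ?L"
      unfolding set_mset_mset[symmetric] mL by simp
    then show ?thesis
      by (metis in_set_conv_nth len)
  qed
  have mL': "mset L = image_mset d (mset_set (UNIV - {i}))"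
    using mL L i by (simp add: mset_set.remove[of UNIV i])
  show ?thesis
  proof (rule that[of i])
    show "d i = eigval A 1"
      by (simp add: eigval_def L i)
    show "d j \<le> eigval A 1" for j
      using nth[of j] anti[of 0] by (auto simp: eigval_def)
    fix j assume "j \<noteq> i"
    then have "d j \<in># mset L"
      unfolding mL' by simp
    then obtain k where k: "k < length L" "d j = L ! k"
      by (auto simp: in_set_conv_nth)
    \<comment> \<open>Position \<open>k\<close> of the tail is position \<open>Suc k\<close> of the
      list, between 1 and \<open>CARD('n) - 1\<close>. As \<open>eigval\<close> counts from 1, these
      two ends are \<open>eigval A 2\<close> and \<open>eigval A CARD('n)\<close>.\<close>
    then have "Suc k < CARD('n)" "d j = ?L ! Suc k"
      using len L by auto
    then show "eigval A CARD('n) \<le> d j \<and> d j \<le> eigval A 2"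
      using anti[of "Suc k" "CARD('n) - 1"] anti[of 1 "Suc k"] by (auto simp: eigval_def)
  qed
qed

section \<open>Perron--Frobenius for connected graphs\<close>

lemma adjacency_nonneg: "0 \<le> adjacency_matrix E $ u $ v"
  by (simp add: adjacency_matrix_def)

lemma transpose_adjacency: "sym E \<Longrightarrow> transpose (adjacency_matrix E) = adjacency_matrix E"
  by (auto simp: adjacency_matrix_def transpose_def vec_eq_iff sym_def)

text \<open>A zero entry spreads along edges: at a vertex where \<open>x\<close> vanishes, the
  eigenvalue equation says that the entries at its neighbours sum to 0, and being nonnegative they
  all vanish. By connectedness \<open>x\<close> would be 0.\<close>

lemma nonneg_eigenvector_pos:
  fixes x :: "real ^ 'v::finite"
  assumes conn: "\<forall>u v. (u, v) \<in> E\<^sup>*" and ev: "adjacency_matrix E *v x = \<mu> *\<^sub>R x"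
    and nn: "\<And>v. 0 \<le> x $ v" and "x \<noteq> 0"
  shows "0 < x $ v"
proof (rule ccontr)
  assume "\<not> 0 < x $ v"
  then have v: "x $ v = 0"
    using nn[of v] by simp
  have "x $ w = 0" for w
  proof -
    have "(v, w) \<in> E\<^sup>*"
      using conn by blast
    then show ?thesis
    proof induction
      case (step y z)
      have "(\<Sum>u\<in>UNIV. adjacency_matrix E $ y $ u * x $ u) = (adjacency_matrix E *v x) $ y"
        by (simp add: matrix_vector_mult_def)
      also have "\<dots> = 0"
        by (simp add: ev step.IH)
      finally have "adjacency_matrix E $ y $ z * x $ z = 0"
        by (subst (asm) sum_nonneg_eq_0_iff) (simp_all add: nn adjacency_nonneg)
      then show ?case
        using step.hyps by (simp add: adjacency_matrix_def)
    qed (rule v)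
  qed
  then show False
    using \<open>x \<noteq> 0\<close> by (simp add: vec_eq_iff)
qed

text \<open>Since \<open>A\<close> has nonnegative entries, replacing \<open>x\<close> by its
  entrywise absolute value \<open>g\<close> does not decrease the form and keeps the norm. So
  \<open>g\<close> lies in the same eigenspace as \<open>x\<close>, and so does
  \<open>g + x\<close>.\<close>

lemma top_eigenvector_sign:
  fixes x :: "real ^ 'v::finite"
  assumes "sym E" and conn: "\<forall>u v. (u, v) \<in> E\<^sup>*" and A: "A = adjacency_matrix E"
    and le: "\<And>z. z \<bullet> (A *v z) \<le> \<mu> * (z \<bullet> z)"
    and ev: "A *v x = \<mu> *\<^sub>R x" and "x \<noteq> 0"
  shows "(\<forall>v. 0 < x $ v) \<or> (\<forall>v. x $ v < 0)"
proof -
  define g where "g = (\<chi> v. \<bar>x $ v\<bar>)"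
  have "x \<bullet> (A *v x) \<le> g \<bullet> (A *v g)"
    unfolding inner_vec_def matrix_vector_mult_def inner_real_def vec_lambda_beta sum_distrib_left
  proof (intro sum_mono)
    fix i j
    have "x $ i * x $ j \<le> g $ i * g $ j"
      by (simp add: g_def flip: abs_mult)
    from mult_left_mono[OF this, of "A $ i $ j"]
    show "x $ i * (A $ i $ j * x $ j) \<le> g $ i * (A $ i $ j * g $ j)"
      by (simp add: A adjacency_nonneg mult_ac)
  qed
  moreover have "g \<bullet> g = x \<bullet> x"
    by (simp add: g_def inner_vec_def)
  ultimately have "\<mu> * (g \<bullet> g) \<le> g \<bullet> (A *v g)"
    by (simp add: ev)
  then have evg: "A *v g = \<mu> *\<^sub>R g"
    using rayleigh_maximizer_eigenvector[of A UNIV \<mu> g] le transpose_adjacency[OF \<open>sym E\<close>]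
    by (simp add: A)
  show ?thesis
  \<comment> \<open>\<open>g + x\<close> is twice the positive part of \<open>x\<close>. If it is 0,
    then \<open>x = - g\<close>; otherwise it is a nonnegative eigenvector, hence positive
    everywhere, which forces every entry of \<open>x\<close> to be positive.\<close>
  proof (cases "g + x = 0")
    case True
    have "g \<noteq> 0"
      using True \<open>x \<noteq> 0\<close> by auto
    then have "0 < g $ v" for v
      using nonneg_eigenvector_pos[OF conn, of g] evg by (simp add: A g_def)
    moreover have "x = - g"
      using True by (simp add: eq_neg_iff_add_eq_0 add.commute)
    ultimately show ?thesis
      by simp
  next
    case False
    have "A *v (g + x) = \<mu> *\<^sub>R (g + x)"
      by (simp add: matrix_vector_right_distrib evg ev scaleR_add_right)
    moreover have "0 \<le> (g + x) $ v" for v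
      by (simp add: g_def)
    ultimately have "0 < (g + x) $ v" for v
      using nonneg_eigenvector_pos[OF conn _ _ False] A by metis
    then have "0 < \<bar>x $ v\<bar> + x $ v" for v
      by (simp add: g_def)
    then have "0 < x $ v" for v
      by (smt (verit))
    then show ?thesis
      by blast
  qed
qed

text \<open>Uniqueness for the definite description: the difference of two distinct candidates would
  be a top eigenvector of constant strict sign, so one positive vector would dominate the other
  entrywise and their norms would differ.\<close>

lemma perron_vector_eqI:
  fixes x :: "real ^ 'v::finite"
  assumes "sym E" and conn: "\<forall>u v. (u, v) \<in> E\<^sup>*" and A: "A = adjacency_matrix E"
    and le: "\<And>z. z \<bullet> (A *v z) \<le> eigval A 1 * (z \<bullet> z)"
    and x: "A *v x = eigval A 1 *\<^sub>R x" "\<forall>v. 0 < x $ v" "norm x = 1"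
  shows "perron_vector A = x"
  unfolding perron_vector_def
proof (rule the_equality)
  fix y assume y: "A *v y = eigval A 1 *\<^sub>R y \<and> (\<forall>v. 0 < y $ v) \<and> norm y = 1"
  have lt: "norm a < norm b" if "\<forall>v. 0 < a $ v" "\<forall>v. a $ v < b $ v" for a b :: "real ^ 'v"
  proof -
    have "a \<bullet> a < b \<bullet> b"
      unfolding inner_vec_def inner_real_def
      using that by (intro sum_strict_mono) (auto intro!: mult_strict_mono intro: less_imp_le less_trans)
    then show ?thesis
      by (simp add: norm_eq_sqrt_inner)
  qed
  show "y = x"
  proof (rule ccontr)
    assume "y \<noteq> x"
    then have "(\<forall>v. 0 < (y - x) $ v) \<or> (\<forall>v. (y - x) $ v < 0)"
      using x y by (intro top_eigenvector_sign[OF assms(1-4)])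
        (simp_all add: matrix_vector_mult_diff_distrib scaleR_diff_right)
    then show False
      using lt[of x y] lt[of y x] x y by auto
  qed
qed (use x in blast)

section \<open>Norms of the restricted and centered Perron vector\<close>

lemma rho_nth: "rho \<nu> U $ v = (if v \<in> U then \<nu> $ v else 0)"
  by (simp add: rho_def axis_def if_distrib cong: if_cong)

lemma inner_rho: "rho \<nu> U \<bullet> \<nu> = (norm (rho \<nu> U))\<^sup>2"
  unfolding power2_norm_eq_inner inner_vec_def by (rule sum.cong) (auto simp: rho_nth)

lemma norm_rho_Compl:
  assumes "norm \<nu> = 1"
  shows "(norm (rho \<nu> (- U)))\<^sup>2 = 1 - (norm (rho \<nu> U))\<^sup>2"
proof -
  have "rho \<nu> (- U) + rho \<nu> U = \<nu>"
    by (simp add: vec_eq_iff rho_nth)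
  then have "(rho \<nu> (- U) + rho \<nu> U) \<bullet> \<nu> = 1"
    using assms by (simp add: norm_eq_1)
  then show ?thesis
    by (simp add: inner_add_left inner_rho)
qed

text \<open>With \<open>s\<close> the squared norm of \<open>rho \<nu> U\<close>, the square of the
  left side is \<open>s - s\<^sup>2 = s * (1 - s)\<close>, and \<open>1 - s\<close> belongs to the
  complement.\<close>

lemma norm_rho_centered:
  assumes "norm \<nu> = 1"
  shows "norm (rho \<nu> U - (norm (rho \<nu> U))\<^sup>2 *\<^sub>R \<nu>) = norm (rho \<nu> U) * norm (rho \<nu> (- U))"
proof -
  let ?s = "(norm (rho \<nu> U))\<^sup>2"
  have "(norm (rho \<nu> U - ?s *\<^sub>R \<nu>))\<^sup>2 = ?s - 2 * ?s * (rho \<nu> U \<bullet> \<nu>) + ?s\<^sup>2 * (\<nu> \<bullet> \<nu>)"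
    unfolding power2_norm_eq_inner
    by (simp add: inner_diff_left inner_diff_right inner_commute power2_eq_square)
  also have "\<dots> = ?s * (1 - ?s)"
    using assms by (simp add: inner_rho norm_eq_1 power2_eq_square algebra_simps)
  also have "\<dots> = (norm (rho \<nu> U) * norm (rho \<nu> (- U)))\<^sup>2"
    by (simp add: norm_rho_Compl[OF assms] power_mult_distrib)
  finally show ?thesis
    by simp
qed

theorem theorem13:
  fixes E :: "('v::finite) rel" and A :: "real ^ 'v ^ 'v" and \<nu> :: "real ^ 'v"
    and lam b :: real and S T :: "'v set"
  assumes "sym E" and "irrefl E"
    and connected: "\<forall>u v. (u, v) \<in> E\<^sup>*"
    and "CARD('v) \<ge> 2"
    and A: "A = adjacency_matrix E"
    and nu: "\<nu> = perron_vector A"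
    and lam: "lam = max \<bar>eigval A 2\<bar> \<bar>eigval A CARD('v)\<bar>"
    and b: "b = (\<Sum>u\<in>S. \<Sum>v\<in>T. A $ u $ v * \<nu> $ u * \<nu> $ v)"
  shows "\<bar>b - eigval A 1 * (norm (rho \<nu> S))\<^sup>2 * (norm (rho \<nu> T))\<^sup>2\<bar>
    \<le> lam * norm (rho \<nu> S) * norm (rho \<nu> T) * norm (rho \<nu> (- S)) * norm (rho \<nu> (- T))"
proof -
  have sym: "transpose A = A"
    using A transpose_adjacency[OF \<open>sym E\<close>] by simp
  obtain f :: "'v \<Rightarrow> real ^ 'v" and d where ev: "\<And>i. A *v f i = d i *\<^sub>R f i"
    and on: "\<And>i j. f i \<bullet> f j = (if i = j then 1 else (0::real))"
    using symmetric_eigenbasis[OF sym] by blast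
  obtain i where i: "d i = eigval A 1" and top: "\<And>j. d j \<le> eigval A 1"
    and rest: "\<And>j. j \<noteq> i \<Longrightarrow> eigval A CARD('v) \<le> d j \<and> d j \<le> eigval A 2"
    using eigval_eigenbasis[OF proots_charpoly_eigenbasis[OF sym ev on]] by blast
  \<comment> \<open>Parseval applied to \<open>x\<close> and \<open>A *v y\<close>, with
    \<open>A\<close> moved onto the eigenvector \<open>f j\<close>.\<close>
  have form: "x \<bullet> (A *v y) = (\<Sum>j\<in>UNIV. d j * ((f j \<bullet> x) * (f j \<bullet> y)))" for x y
    by (simp add: orthonormal_inner_expand[OF on, of x] symmetric_inner_swap[OF sym, of "f _"] ev
        mult_ac)
  have le: "z \<bullet> (A *v z) \<le> eigval A 1 * (z \<bullet> z)" for z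
    unfolding form orthonormal_inner_expand[OF on, of z z] sum_distrib_left
    by (intro sum_mono mult_right_mono top) simp
  have fi: "norm (f i) = 1"
    using on[of i i] by (simp add: norm_eq_1)
  then have "f i \<noteq> 0"
    by auto
  then have "(\<forall>v. 0 < f i $ v) \<or> (\<forall>v. f i $ v < 0)"
    using top_eigenvector_sign[OF \<open>sym E\<close> connected A le] ev[of i] i by simp
  \<comment> \<open>The eigenbasis fixes \<open>f i\<close> only up to sign, while
    \<open>\<nu>\<close> is the positive choice. Norm, eigenvalue equation and orthogonality are the
    same for both signs.\<close>
  then have "\<nu> = f i \<or> \<nu> = - f i"
  proof
    assume "\<forall>v. 0 < f i $ v"
    then have "\<nu> = f i"
      using perron_vector_eqI[OF \<open>sym E\<close> connected A le, of "f i"] ev[of i] i fi nu by simp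
    then show ?thesis ..
  next
    assume "\<forall>v. f i $ v < 0"
    moreover have "A *v (- f i) = eigval A 1 *\<^sub>R (- f i)"
      using ev[of i] i matrix_vector_mult_scaleR[of A "- 1" "f i"] by simp
    ultimately have "\<nu> = - f i"
      using perron_vector_eqI[OF \<open>sym E\<close> connected A le, of "- f i"] fi nu by simp
    then show ?thesis ..
  qed
  then have nu1: "norm \<nu> = 1" and nuev: "A *v \<nu> = eigval A 1 *\<^sub>R \<nu>"
    and fi_orth: "\<And>x. x \<bullet> \<nu> = 0 \<Longrightarrow> f i \<bullet> x = 0"
    using fi ev[of i] i matrix_vector_mult_scaleR[of A "- 1" "f i"] by (auto simp: inner_commute)
  \<comment> \<open>The term at \<open>i\<close> has the factor \<open>f i \<bullet> x\<close>,
    which is 0. Every other \<open>d j\<close> lies between the smallest and the second largest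
    eigenvalue, so its absolute value is at most \<open>lam\<close>.\<close>
  have bound: "\<bar>x \<bullet> (A *v y)\<bar> \<le> lam * (norm x * norm y)" if "x \<bullet> \<nu> = 0" for x y
  proof -
    have "\<bar>x \<bullet> (A *v y)\<bar> \<le> (\<Sum>j\<in>UNIV. lam * (\<bar>f j \<bullet> x\<bar> * \<bar>f j \<bullet> y\<bar>))"
      unfolding form
    proof (rule order_trans[OF sum_abs], rule sum_mono)
      fix j
      show "\<bar>d j * ((f j \<bullet> x) * (f j \<bullet> y))\<bar> \<le> lam * (\<bar>f j \<bullet> x\<bar> * \<bar>f j \<bullet> y\<bar>)"
      proof (cases "j = i")
        case True
        then show ?thesis
          using fi_orth[OF that] by simp
      next
        case False
        have "\<bar>d j\<bar> \<le> lam"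
          using rest[OF False] lam by linarith
        then show ?thesis
          by (simp add: abs_mult mult_right_mono)
      qed
    qed
    \<comment> \<open>Cauchy--Schwarz on the coordinates; by Parseval their \<open>L2_set\<close>
      values are the norms of \<open>x\<close> and \<open>y\<close>.\<close>
    also have "\<dots> \<le> lam * (L2_set (\<lambda>j. f j \<bullet> x) UNIV * L2_set (\<lambda>j. f j \<bullet> y) UNIV)"
      unfolding sum_distrib_left[symmetric]
      by (intro mult_left_mono L2_set_mult_ineq) (simp add: lam)
    also have "\<dots> = lam * (norm x * norm y)"
      by (simp add: L2_set_def norm_eq_sqrt_inner orthonormal_inner_expand[OF on, of x x]
          orthonormal_inner_expand[OF on, of y y] power2_eq_square)
    finally show ?thesis .
  qed
  define s t where "s = (norm (rho \<nu> S))\<^sup>2" and "t = (norm (rho \<nu> T))\<^sup>2"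
  define x y where "x = rho \<nu> S - s *\<^sub>R \<nu>" and "y = rho \<nu> T - t *\<^sub>R \<nu>"
  have nn: "\<nu> \<bullet> \<nu> = 1"
    using nu1 by (simp add: norm_eq_1)
  have orth: "x \<bullet> \<nu> = 0"
    by (simp add: x_def s_def inner_diff_left inner_rho nn)
  have "b = rho \<nu> S \<bullet> (A *v rho \<nu> T)"
    unfolding b inner_vec_def matrix_vector_mult_def
    by (simp add: rho_nth if_distrib if_distribR sum_distrib_left sum.If_cases mult_ac
        cong: if_cong)
  also have "\<dots> = x \<bullet> (A *v y) + eigval A 1 * s * t"
  proof -
    \<comment> \<open>Only one factor is changed at a time. Changing the second costs nothing, since
      \<open>A *v \<nu>\<close> is a multiple of \<open>\<nu>\<close> and \<open>x\<close> is
      orthogonal to \<open>\<nu>\<close>; changing the first gives the main term, since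
      \<open>rho \<nu> T \<bullet> \<nu> = t\<close>.\<close>
    have "rho \<nu> S \<bullet> (A *v rho \<nu> T) - x \<bullet> (A *v y)
      = (rho \<nu> S - x) \<bullet> (A *v rho \<nu> T) + x \<bullet> (A *v (rho \<nu> T - y))"
      by (simp add: inner_diff_left inner_diff_right matrix_vector_mult_diff_distrib)
    also have "x \<bullet> (A *v (rho \<nu> T - y)) = 0"
      by (simp add: y_def matrix_vector_mult_scaleR nuev orth)
    also have "(rho \<nu> S - x) \<bullet> (A *v rho \<nu> T) = s * (eigval A 1 * t)"
      by (simp add: x_def symmetric_inner_swap[OF sym, of \<nu>] nuev t_def
          inner_commute[of \<nu> "rho \<nu> T"] inner_rho)
    finally show ?thesis
      by (simp add: algebra_simps)
  qed
  finally have "b - eigval A 1 * s * t = x \<bullet> (A *v y)"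
    by simp
  then show ?thesis
    using bound[OF orth, of y] norm_rho_centered[OF nu1, of S] norm_rho_centered[OF nu1, of T]
    by (simp add: x_def y_def s_def t_def mult_ac)
qed

end
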